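(* Let $X \in {\rm M}(2,\mathbb{C})$ be a $\sigma$-symmetric matrix, $f$ the corresponding $\sigma$-form and let $(\xi, \eta)^t\in \mathbb{C}^2$ be a nontrivial zero of $f$. Let $\{g_n\}$ be the sequence in $\rm GL(2,\mathbb{Z})$ associated with a continued fraction expansion of $\xi/\eta$ and $N\subset \mathbb{N}$ be a neat infinite subset for the expansion. Then $\{X_{g_n, \sigma}\mid n\in N\}$ is a bounded subset in ${\rm M}(2,\mathbb{C})$. Moreover, for any $X\in {\rm M}(2,k^{-1} \Gamma)$, where $k\in \mathbb{N}$, $\{X_{g_n,\sigma}\mid n\in N\}$ is finite.
   Context: $\Gamma$ is a discrete subring of $\mathbb{C}$ containing $1$ (in the setting of interest, a Euclidean subring), $K$ its quotient field and $\mathbb{C}'=\mathbb{C}\setminus K$. For $z\in\mathbb{C}'$, a continued fraction expansion of $z$ is a sequence $\{a_n\}_{n\ge0}$ in $\Gamma$ for which there is a sequence $\{z_n\}_{n\geq0}$ (the iteration sequence) with $z_0=z$, $0<|z_n-a_n|<1$ and $z_{n+1}=(z_n-a_n)^{-1}$ for all $n\ge0$. The associated sequences are $p_{-1}=1$, $p_0=a_0$, $p_n=a_np_{n-1}+p_{n-2}$ and $q_{-1}=0$, $q_0=1$, $q_n=a_nq_{n-1}+q_{n-2}$ for $n\ge1$, and $g_n=\begin{pmatrix} p_n & p_{n-1}\\ q_n & q_{n-1}\end{pmatrix}$ for $n\ge0$ (each of determinant $\pm1$). A subset $N\subset\mathbb{N}$ is neat for the expansion if $|q_{n-1}|\le|q_n|$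 for all $n\in N$ and $\liminf_{n\in N}|z_{n+1}|>1$. The map $\sigma:\mathbb{C}\to\mathbb{C}$ is either the identity or complex conjugation, $\xi^\sigma=\sigma(\xi)$, and for a matrix $X$, $X^\sigma$ is obtained by applying $\sigma$ entrywise and $X^t$ is its transpose. $X$ is $\sigma$-symmetric if $X^t=X^\sigma$. For $X=\begin{pmatrix}A&B\\C&D\end{pmatrix}$ the $\sigma$-form is $f(\xi,\eta)=A\xi^\sigma\xi+B\xi^\sigma\eta+C\eta^\sigma\xi+D\eta^\sigma\eta$. A nontrivial zero of $f$ is $(\xi,\eta)^t\in\mathbb{C}^2$ with $\eta\ne0$, $\xi/\eta\in\mathbb{C}'$ and $f(\xi,\eta)=0$. For $g\in{\rm GL}(2,\mathbb{C})$, $X_{g,\sigma}=(g^t)^\sigma X g$. ${\rm M}(2,k^{-1}\Gamma)$ denotes $2\times2$ matrices with entries in $k^{-1}\Gamma$. *)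

theory Defs
  imports "HOL-Analysis.Analysis"
begin

definition discrete_subring :: "complex set \<Rightarrow> bool" where
  "discrete_subring \<Gamma> \<longleftrightarrow>
     1 \<in> \<Gamma> \<and>
     (\<forall>x\<in>\<Gamma>. \<forall>y\<in>\<Gamma>. x - y \<in> \<Gamma>) \<and>
     (\<forall>x\<in>\<Gamma>. \<forall>y\<in>\<Gamma>. x * y \<in> \<Gamma>) \<and>
     discrete \<Gamma>"

definition quotient_field :: "complex set \<Rightarrow> complex set" where
  "quotient_field \<Gamma> = {x / y | x y. x \<in> \<Gamma> \<and> y \<in> \<Gamma> \<and> y \<noteq> 0}"

definition is_iteration_seq :: "complex \<Rightarrow> (nat \<Rightarrow> complex) \<Rightarrow> (nat \<Rightarrow> complex) \<Rightarrow> bool" where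
  "is_iteration_seq z a zs \<longleftrightarrow>
     zs 0 = z \<and>
     (\<forall>n. 0 < cmod (zs n - a n) \<and> cmod (zs n - a n) < 1 \<and> zs (Suc n) = inverse (zs n - a n))"

definition is_cf_expansion :: "complex set \<Rightarrow> complex \<Rightarrow> (nat \<Rightarrow> complex) \<Rightarrow> bool" where
  "is_cf_expansion \<Gamma> z a \<longleftrightarrow>
     z \<notin> quotient_field \<Gamma> \<and> (\<forall>n. a n \<in> \<Gamma>) \<and> (\<exists>zs. is_iteration_seq z a zs)"

text \<open>
  The sequences \<open>p\<close> and \<open>q\<close> start at index \<open>-1\<close>, so the index is shifted by one:
  \<open>p\<^sub>n\<close> is \<open>cf_p a (Suc n)\<close> and \<open>p\<^sub>n\<^sub>-\<^sub>1\<close> is \<open>cf_p a n\<close>; likewise for \<open>q\<close>.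
\<close>

fun cf_p :: "(nat \<Rightarrow> complex) \<Rightarrow> nat \<Rightarrow> complex" where
  "cf_p a 0 = 1"
| "cf_p a (Suc 0) = a 0"
| "cf_p a (Suc (Suc n)) = a (Suc n) * cf_p a (Suc n) + cf_p a n"

fun cf_q :: "(nat \<Rightarrow> complex) \<Rightarrow> nat \<Rightarrow> complex" where
  "cf_q a 0 = 0"
| "cf_q a (Suc 0) = 1"
| "cf_q a (Suc (Suc n)) = a (Suc n) * cf_q a (Suc n) + cf_q a n"

definition cf_g :: "(nat \<Rightarrow> complex) \<Rightarrow> nat \<Rightarrow> complex^2^2" where
  "cf_g a n = vector [vector [cf_p a (Suc n), cf_p a n],
                      vector [cf_q a (Suc n), cf_q a n]]"

text \<open>
  The iteration sequence \<open>zs\<close> of an expansion \<open>a\<close> of \<open>z\<close> is uniquely determined by \<open>z\<close> and \<open>a\<close>.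
  The lower limit is taken in the extended reals, along the indices in \<open>N\<close> tending to infinity.
\<close>

definition neat :: "complex \<Rightarrow> (nat \<Rightarrow> complex) \<Rightarrow> nat set \<Rightarrow> bool" where
  "neat z a N \<longleftrightarrow>
     (\<forall>n\<in>N. cmod (cf_q a n) \<le> cmod (cf_q a (Suc n))) \<and>
     (\<exists>zs. is_iteration_seq z a zs \<and>
        Liminf (inf sequentially (principal N)) (\<lambda>n. ereal (cmod (zs (Suc n)))) > 1)"

definition sigma_symmetric :: "(complex \<Rightarrow> complex) \<Rightarrow> complex^2^2 \<Rightarrow> bool" where
  "sigma_symmetric \<sigma> X \<longleftrightarrow> transpose X = map_matrix \<sigma> X"

definition sigma_form ::
    "(complex \<Rightarrow> complex) \<Rightarrow> complex^2^2 \<Rightarrow> complex \<Rightarrow> complex \<Rightarrow> complex" where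
  "sigma_form \<sigma> X \<xi> \<eta> =
     X$1$1 * \<sigma> \<xi> * \<xi> + X$1$2 * \<sigma> \<xi> * \<eta> + X$2$1 * \<sigma> \<eta> * \<xi> + X$2$2 * \<sigma> \<eta> * \<eta>"

definition nontrivial_zero ::
    "complex set \<Rightarrow> (complex \<Rightarrow> complex \<Rightarrow> complex) \<Rightarrow> complex \<Rightarrow> complex \<Rightarrow> bool" where
  "nontrivial_zero \<Gamma> f \<xi> \<eta> \<longleftrightarrow> \<eta> \<noteq> 0 \<and> \<xi> / \<eta> \<notin> quotient_field \<Gamma> \<and> f \<xi> \<eta> = 0"

definition sigma_transform ::
    "(complex \<Rightarrow> complex) \<Rightarrow> complex^2^2 \<Rightarrow> complex^2^2 \<Rightarrow> complex^2^2" where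
  "sigma_transform \<sigma> X g = map_matrix \<sigma> (transpose g) ** X ** g"

definition mat2_over :: "complex set \<Rightarrow> (complex^2^2) set" where
  "mat2_over S = {X. \<forall>i j. X$i$j \<in> S}"

end

theory Submission
  imports Defs
begin

text \<open>Put \<open>z = \<xi> / \<eta>\<close> and \<open>e\<^sub>n = q\<^sub>n z - p\<^sub>n\<close>. The identity
  \<open>\<bar>e\<^sub>n\<bar> \<bar>q\<^sub>n z\<^sub>n\<^sub>+\<^sub>1 + q\<^sub>n\<^sub>-\<^sub>1\<bar> = 1\<close> and neatness bound the products \<open>q\<^sub>i e\<^sub>j\<close>
  for \<open>i\<close>, \<open>j\<close> in \<open>{n - 1, n}\<close>. The columns of \<open>g\<^sub>n\<close> are \<open>q\<^sub>i (z, 1) - e\<^sub>i (1, 0)\<close> and \<open>(z, 1)\<close>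
  is a zero of the form, so the entries of the transformed matrix involve \<open>q\<^sub>i\<close> only through
  these products. For finiteness, nonzero elements of a discrete subring have modulus at least 1,
  so its bounded subsets are finite, and the subring is closed under conjugation.\<close>

section \<open>Discrete subrings of the complex numbers\<close>

lemma discrete_subring_zero: "discrete_subring \<Gamma> \<Longrightarrow> 0 \<in> \<Gamma>"
  unfolding discrete_subring_def by (metis diff_self)

lemma discrete_subring_diff: "discrete_subring \<Gamma> \<Longrightarrow> x \<in> \<Gamma> \<Longrightarrow> y \<in> \<Gamma> \<Longrightarrow> x - y \<in> \<Gamma>"
  unfolding discrete_subring_def by blast

lemma discrete_subring_mult: "discrete_subring \<Gamma> \<Longrightarrow> x \<in> \<Gamma> \<Longrightarrow> y \<in> \<Gamma> \<Longrightarrow> x * y \<in> \<Gamma>"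
  unfolding discrete_subring_def by blast

lemma discrete_subring_uminus: "discrete_subring \<Gamma> \<Longrightarrow> x \<in> \<Gamma> \<Longrightarrow> - x \<in> \<Gamma>"
  using discrete_subring_diff[OF _ discrete_subring_zero, of \<Gamma> x] by simp

lemma discrete_subring_add: "discrete_subring \<Gamma> \<Longrightarrow> x \<in> \<Gamma> \<Longrightarrow> y \<in> \<Gamma> \<Longrightarrow> x + y \<in> \<Gamma>"
  using discrete_subring_diff[of \<Gamma> x "- y"] discrete_subring_uminus[of \<Gamma> y] by simp

lemma discrete_subring_of_int:
  assumes "discrete_subring \<Gamma>" shows "of_int m \<in> \<Gamma>"
proof (induction m rule: int_induct[where k = 0])
  case base
  then show ?case using discrete_subring_zero[OF assms] by simp
next
  case (step1 i)
  then show ?case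
    using discrete_subring_add[OF assms, of "of_int i" 1] assms
    by (simp add: discrete_subring_def)
next
  case (step2 i)
  then show ?case
    using discrete_subring_diff[OF assms, of "of_int i" 1] assms
    by (simp add: discrete_subring_def)
qed

lemma discrete_subring_power: "discrete_subring \<Gamma> \<Longrightarrow> x \<in> \<Gamma> \<Longrightarrow> x ^ n \<in> \<Gamma>"
  by (induction n) (auto simp: discrete_subring_mult, simp add: discrete_subring_def)

text \<open>The powers of a nonzero element of modulus less than 1 would accumulate at 0.\<close>
lemma discrete_subring_norm_ge_1:
  assumes \<Gamma>: "discrete_subring \<Gamma>" and x: "x \<in> \<Gamma>" "x \<noteq> 0"
  shows "1 \<le> cmod x"
proof (rule ccontr)
  assume "\<not> 1 \<le> cmod x"
  then have lim: "(\<lambda>n. x ^ n) \<longlonglongrightarrow> 0"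
    by (intro LIMSEQ_power_zero) simp
  have "0 isolated_in \<Gamma>"
    using \<Gamma> discrete_subring_zero[OF \<Gamma>] by (auto simp: discrete_subring_def discrete_def)
  then obtain e where e: "e > 0" "\<And>y. y \<in> \<Gamma> \<Longrightarrow> cmod y < e \<Longrightarrow> y = 0"
    by (auto simp: isolated_in_dist_Ex_iff)
  obtain n where "cmod (x ^ n) < e"
    using LIMSEQ_D[OF lim e(1)] by auto
  with e(2)[OF discrete_subring_power[OF \<Gamma> x(1)]] x(2) show False by simp
qed

text \<open>Subtracting the integer part leaves an element of modulus less than 1, which must be
  0.\<close>

lemma discrete_subring_real_imp_int:
  assumes \<Gamma>: "discrete_subring \<Gamma>" and x: "x \<in> \<Gamma>" "Im x = 0"
  shows "\<exists>m::int. x = of_int m"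
proof -
  define y where "y = x - of_int \<lfloor>Re x\<rfloor>"
  have "y \<in> \<Gamma>"
    unfolding y_def by (intro discrete_subring_diff discrete_subring_of_int \<Gamma> x)
  moreover have "y = of_real (frac (Re x))"
    using x(2) by (simp add: y_def complex_eq_iff frac_def)
  then have "cmod y < 1"
    using frac_lt_1[of "Re x"] by simp
  ultimately have "y = 0"
    using discrete_subring_norm_ge_1[OF \<Gamma>] by force
  then show ?thesis unfolding y_def by auto
qed

text \<open>Differences of distinct points are nonzero elements of the ring, so the points are at
  least 1 apart.\<close>

lemma finite_discrete_subring_bounded:
  assumes \<Gamma>: "discrete_subring \<Gamma>" and S: "S \<subseteq> \<Gamma>" "bounded S"
  shows "finite S"
proof -
  have "1 \<le> dist x y" if "x \<in> S" "y \<in> S" "x \<noteq> y" for x y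
    using discrete_subring_norm_ge_1[OF \<Gamma> discrete_subring_diff[OF \<Gamma>, of x y]] that S(1)
    by (auto simp: dist_norm)
  then have "uniform_discrete S"
    unfolding uniform_discrete_def by (intro exI[of _ 1]) force
  then show ?thesis
    using S(2) uniform_discrete_finite_iff by blast
qed

text \<open>If the ring is not contained in the reals, an element \<open>y\<close> of least positive imaginary part
  generates it over the integers together with 1; then \<open>y\<^sup>2\<close> is an integral combination of
  \<open>1\<close> and \<open>y\<close>, so the trace of \<open>y\<close> is an integer.\<close>
lemma discrete_subring_cnj:
  assumes \<Gamma>: "discrete_subring \<Gamma>" and x: "x \<in> \<Gamma>"
  shows "cnj x \<in> \<Gamma>"
proof (cases "\<exists>w\<in>\<Gamma>. Im w \<noteq> 0")
  case False
  then have "cnj x = x" using x by (simp add: complex_eq_iff)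
  then show ?thesis using x by simp
next
  case True
  then obtain w where w: "w \<in> \<Gamma>" "Im w > 0"
    using discrete_subring_uminus[OF \<Gamma>]
    by (metis linorder_neqE_linordered_idom neg_0_less_iff_less uminus_complex.sel(2))
  \<comment> \<open>Integer translations bring the real part into [0, 1). This makes
    \<open>S\<close> bounded, hence finite, so a least imaginary part is attained.\<close>
  define S where "S = {v \<in> \<Gamma>. 0 < Im v \<and> Im v \<le> Im w \<and> 0 \<le> Re v \<and> Re v < 1}"
  have reduce: "v - of_int \<lfloor>Re v\<rfloor> \<in> S" if "v \<in> \<Gamma>" "0 < Im v" "Im v \<le> Im w" for v
    using that discrete_subring_diff[OF \<Gamma> that(1) discrete_subring_of_int[OF \<Gamma>], of "\<lfloor>Re v\<rfloor>"]
    unfolding S_def by (auto simp: algebra_simps) linarith+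
  have "bounded S"
  proof (rule boundedI)
    fix v assume "v \<in> S"
    then have "\<bar>Re v\<bar> \<le> 1" "\<bar>Im v\<bar> \<le> Im w" by (auto simp: S_def)
    then show "norm v \<le> 1 + Im w" using cmod_le[of v] by linarith
  qed
  then have "finite S"
    using finite_discrete_subring_bounded[OF \<Gamma>] by (auto simp: S_def)
  moreover have "S \<noteq> {}" using reduce[OF w] by auto
  ultimately obtain y where y: "y \<in> S" and ymin: "\<And>v. v \<in> S \<Longrightarrow> Im y \<le> Im v"
    by (metis arg_min_if_finite(1) arg_min_least)
  have y\<Gamma>: "y \<in> \<Gamma>" and Imy: "0 < Im y" "Im y \<le> Im w" using y by (auto simp: S_def)
  have gen: "\<exists>k m::int. v = of_int k + of_int m * y" if v: "v \<in> \<Gamma>" for v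
  proof -
    define m where "m = \<lfloor>Im v / Im y\<rfloor>"
    define u where "u = v - of_int m * y"
    have u: "u \<in> \<Gamma>"
      unfolding u_def
      by (intro discrete_subring_diff discrete_subring_mult discrete_subring_of_int \<Gamma> v y\<Gamma>)
    have Imu: "Im u = frac (Im v / Im y) * Im y"
      using Imy by (simp add: u_def m_def frac_def field_simps)
    then have "0 \<le> Im u" and "Im u < Im y"
      using Imy frac_lt_1[of "Im v / Im y"] by auto
    \<comment> \<open>Otherwise an integer translate of \<open>u\<close> would lie in
      \<open>S\<close> below \<open>y\<close>.\<close>
    moreover have "\<not> 0 < Im u"
      using reduce[OF u] ymin[of "u - of_int \<lfloor>Re u\<rfloor>"] \<open>Im u < Im y\<close> Imy by fastforce
    ultimately have "Im u = 0" by simp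
    then obtain k :: int where "u = of_int k"
      using discrete_subring_real_imp_int[OF \<Gamma> u] by auto
    then have "v = of_int k + of_int m * y" by (simp add: u_def algebra_simps)
    then show ?thesis by blast
  qed
  obtain k m :: int where "y * y = of_int k + of_int m * y"
    using gen[OF discrete_subring_mult[OF \<Gamma> y\<Gamma> y\<Gamma>]] by auto
  then have "Im (y * y) = Im (of_int k + of_int m * y)" by simp
  \<comment> \<open>The imaginary part of \<open>y * y\<close> is \<open>2 * Re y * Im y\<close>,
    and the factor \<open>Im y\<close> cancels.\<close>
  then have "2 * Re y = of_int m" using Imy by simp
  then have "cnj y = of_int m - y" by (simp add: complex_eq_iff)
  then have cnjy: "cnj y \<in> \<Gamma>"
    using discrete_subring_diff[OF \<Gamma> discrete_subring_of_int[OF \<Gamma>] y\<Gamma>] by simp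
  obtain i j :: int where "x = of_int i + of_int j * y" using gen[OF x] by auto
  then have "cnj x = of_int i + of_int j * cnj y" by simp
  then show ?thesis
    using discrete_subring_add discrete_subring_mult discrete_subring_of_int \<Gamma> cnjy by simp
qed

section \<open>Approximation by convergents\<close>

lemma cf_p_in_subring:
  assumes "discrete_subring \<Gamma>" "\<And>n. a n \<in> \<Gamma>"
  shows "cf_p a n \<in> \<Gamma>"
  by (induction n rule: induct_nat_012)
     (use assms in \<open>auto intro!: discrete_subring_add discrete_subring_mult simp: discrete_subring_def\<close>)

lemma cf_q_in_subring:
  assumes "discrete_subring \<Gamma>" "\<And>n. a n \<in> \<Gamma>"
  shows "cf_q a n \<in> \<Gamma>"
  by (induction n rule: induct_nat_012)
     (use assms in \<open>auto intro!: discrete_subring_add discrete_subring_mult discrete_subring_zero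
       simp: discrete_subring_def\<close>)

text \<open>In the notation of the paper, \<open>cf_err z a n\<close> is \<open>q\<^sub>n\<^sub>-\<^sub>1 z - p\<^sub>n\<^sub>-\<^sub>1\<close>.\<close>
definition cf_err :: "complex \<Rightarrow> (nat \<Rightarrow> complex) \<Rightarrow> nat \<Rightarrow> complex" where
  "cf_err z a n = cf_q a n * z - cf_p a n"

lemma iteration_seq_norm_gt_1:
  assumes "is_iteration_seq z a zs"
  shows "1 < cmod (zs (Suc n))"
proof -
  have "0 < cmod (zs n - a n)" "cmod (zs n - a n) < 1" "zs (Suc n) = inverse (zs n - a n)"
    using assms by (auto simp: is_iteration_seq_def)
  then show ?thesis by (simp add: norm_inverse one_less_inverse)
qed

lemma iteration_seq_step:
  assumes "is_iteration_seq z a zs"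
  shows "zs n * zs (Suc n) = a n * zs (Suc n) + 1"
proof -
  have "zs n - a n \<noteq> 0" "zs (Suc n) = inverse (zs n - a n)"
    using assms unfolding is_iteration_seq_def by (metis norm_zero less_irrefl)+
  then show ?thesis by (simp add: field_simps)
qed

text \<open>The errors obey the same three-term recursion as numerators and denominators, and the
  iteration sequence records the negated ratios of consecutive errors.\<close>

lemma cf_err_Suc:
  assumes it: "is_iteration_seq z a zs"
  shows "cf_err z a (Suc n) * zs (Suc n) = - cf_err z a n"
proof (induction n)
  case 0
  have "zs 0 = z" using it by (simp add: is_iteration_seq_def)
  with iteration_seq_step[OF it, of 0] show ?case
    by (simp add: cf_err_def algebra_simps)
next
  case (Suc n)
  have "cf_err z a (Suc (Suc n)) = a (Suc n) * cf_err z a (Suc n) + cf_err z a n"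
    by (simp add: cf_err_def algebra_simps)
  \<comment> \<open>The induction hypothesis turns the older error into a multiple of the newer
    one.\<close>
  also have "\<dots> = (a (Suc n) - zs (Suc n)) * cf_err z a (Suc n)"
    using Suc by (simp add: algebra_simps)
  finally have "cf_err z a (Suc (Suc n)) * zs (Suc (Suc n)) =
      (a (Suc n) * zs (Suc (Suc n)) - zs (Suc n) * zs (Suc (Suc n))) * cf_err z a (Suc n)"
    by (simp add: left_diff_distrib right_diff_distrib mult_ac)
  then show ?case using iteration_seq_step[OF it, of "Suc n"] by simp
qed

lemma cf_err_norm_Suc:
  assumes "is_iteration_seq z a zs"
  shows "cmod (cf_err z a n) = cmod (cf_err z a (Suc n)) * cmod (zs (Suc n))"
  using cf_err_Suc[OF assms, of n] by (metis norm_minus_cancel norm_mult)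

text \<open>The error at index 0 is -1, and each step divides the modulus by some
  \<open>cmod (zs (Suc n)) > 1\<close>.\<close>

lemma cf_err_norm_le_1:
  assumes it: "is_iteration_seq z a zs"
  shows "cmod (cf_err z a n) \<le> 1"
proof (induction n)
  case 0
  then show ?case by (simp add: cf_err_def)
next
  case (Suc n)
  have "cmod (cf_err z a (Suc n)) \<le> cmod (cf_err z a (Suc n)) * cmod (zs (Suc n))"
    using iteration_seq_norm_gt_1[OF it, of n] by (simp add: mult_le_cancel_left1)
  with Suc show ?case using cf_err_norm_Suc[OF it, of n] by simp
qed

text \<open>The product is invariant: passing to the next index divides the error by
  \<open>zs (Suc (Suc n))\<close> in modulus and multiplies the second factor by it.\<close>

lemma cf_err_mult_denominator:
  assumes it: "is_iteration_seq z a zs"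
  shows "cmod (cf_err z a (Suc n)) * cmod (cf_q a (Suc n) * zs (Suc n) + cf_q a n) = 1"
proof (induction n)
  case 0
  have "zs 0 = z" using it by (simp add: is_iteration_seq_def)
  with iteration_seq_step[OF it, of 0]
  have "cf_err z a (Suc 0) * (cf_q a (Suc 0) * zs (Suc 0) + cf_q a 0) = 1"
    by (simp add: cf_err_def algebra_simps)
  then show ?case by (metis norm_mult norm_one)
next
  case (Suc n)
  let ?w = "cf_q a (Suc n) * zs (Suc n) + cf_q a n"
  have "cf_q a (Suc (Suc n)) * zs (Suc (Suc n)) + cf_q a (Suc n) =
      (a (Suc n) * zs (Suc (Suc n)) + 1) * cf_q a (Suc n) + cf_q a n * zs (Suc (Suc n))"
    by (simp add: algebra_simps)
  also have "\<dots> = zs (Suc (Suc n)) * ?w"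
    unfolding iteration_seq_step[OF it, of "Suc n", symmetric] by (simp add: algebra_simps)
  finally show ?case
    using Suc cf_err_norm_Suc[OF it, of "Suc n"] by (simp add: norm_mult mult.assoc)
qed

text \<open>By the triangle inequality the second factor in \<open>cf_err_mult_denominator\<close>
  has modulus at least \<open>cmod (cf_q a (Suc n)) * (cmod (zs (Suc n)) - 1)\<close>.\<close>

lemma cf_err_mult_q_le:
  assumes it: "is_iteration_seq z a zs"
    and q: "cmod (cf_q a n) \<le> cmod (cf_q a (Suc n))"
    and z: "1 + \<delta> \<le> cmod (zs (Suc n))" and \<delta>: "0 < \<delta>"
    and ij: "i \<in> {n, Suc n}" "j \<in> {n, Suc n}"
  shows "cmod (cf_q a i) * cmod (cf_err z a j) \<le> (1 + \<delta>) / \<delta>"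
proof -
  let ?e = "cmod (cf_err z a (Suc n))" and ?q = "cmod (cf_q a (Suc n))"
    and ?r = "cmod (zs (Suc n))"
  have "?q * ?r - ?q \<le> cmod (cf_q a (Suc n) * zs (Suc n) + cf_q a n)"
    using norm_diff_ineq[of "cf_q a (Suc n) * zs (Suc n)" "cf_q a n"] q by (simp add: norm_mult)
  then have "?e * (?q * ?r - ?q) \<le> 1"
    using cf_err_mult_denominator[OF it, of n] by (metis mult_left_mono norm_ge_zero)
  then have 1: "(?q * ?e) * (?r - 1) \<le> 1" by (simp add: algebra_simps)
  have "(?q * ?e) * \<delta> \<le> (?q * ?e) * (?r - 1)"
    using z by (intro mult_left_mono) auto
  with 1 have 2: "?q * ?e \<le> 1 / \<delta>" using \<delta> by (simp add: field_simps)
  have eq: "(1 + \<delta>) / \<delta> = 1 / \<delta> + 1" using \<delta> by (simp add: field_simps)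
  \<comment> \<open>Splitting \<open>?r\<close> as \<open>(?r - 1) + 1\<close> gives the two
    summands 1 and \<open>1 / \<delta>\<close>.\<close>
  have "?q * (?e * ?r) \<le> (1 + \<delta>) / \<delta>"
    unfolding eq using 1 2 by (simp add: algebra_simps)
  then have big: "?q * cmod (cf_err z a n) \<le> (1 + \<delta>) / \<delta>"
    by (simp add: cf_err_norm_Suc[OF it, of n])
  \<comment> \<open>The larger denominator and the older error give the largest of the four
    products.\<close>
  have "cmod (cf_q a i) \<le> ?q" using ij(1) q by auto
  moreover have "cmod (cf_err z a j) \<le> cmod (cf_err z a n)"
    using ij(2) iteration_seq_norm_gt_1[OF it, of n]
    by (auto simp: cf_err_norm_Suc[OF it, of n] mult_le_cancel_left1)
  ultimately have "cmod (cf_q a i) * cmod (cf_err z a j) \<le> ?q * cmod (cf_err z a n)"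
    by (intro mult_mono) auto
  with big show ?thesis by linarith
qed

section \<open>The transformed matrices\<close>

text \<open>This is the polarization of \<open>sigma_form\<close>, sesquilinear when
  \<open>\<sigma> = cnj\<close>: its diagonal is the form itself, and its values at pairs of columns
  of a matrix are the entries of the transform.\<close>

definition sigma_bilinear ::
    "(complex \<Rightarrow> complex) \<Rightarrow> complex^2^2 \<Rightarrow> complex \<times> complex \<Rightarrow> complex \<times> complex \<Rightarrow> complex" where
  "sigma_bilinear \<sigma> X u v =
     \<sigma> (fst u) * (X$1$1 * fst v + X$1$2 * snd v) + \<sigma> (snd u) * (X$2$1 * fst v + X$2$2 * snd v)"

text \<open>Column 1 of \<open>cf_g a n\<close> carries the index \<open>Suc n\<close> and column 2
  the index \<open>n\<close>. The bounds are uniform over both, so only membership is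
  recorded.\<close>

lemma sigma_transform_cf_g_component:
  "\<exists>s\<in>{n, Suc n}. \<exists>t\<in>{n, Suc n}. \<forall>X \<sigma>. sigma_transform \<sigma> X (cf_g a n) $ i $ j =
     sigma_bilinear \<sigma> X (cf_p a s, cf_q a s) (cf_p a t, cf_q a t)"
  using exhaust_2[of i] exhaust_2[of j]
  by (auto simp: sigma_transform_def sigma_bilinear_def cf_g_def matrix_matrix_mult_def
      map_matrix_def transpose_def sum_2 algebra_simps)

text \<open>By homogeneity, scaling the vector by \<open>\<eta>\<close> multiplies the form by
  \<open>\<sigma> \<eta> * \<eta>\<close>, which is nonzero.\<close>

lemma sigma_form_ratio_zero:
  assumes "\<sigma> = id \<or> \<sigma> = cnj" "\<eta> \<noteq> 0" "sigma_form \<sigma> X \<xi> \<eta> = 0"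
  shows "sigma_bilinear \<sigma> X (\<xi> / \<eta>, 1) (\<xi> / \<eta>, 1) = 0"
proof -
  have "sigma_bilinear \<sigma> X (\<xi> / \<eta>, 1) (\<xi> / \<eta>, 1) * (\<sigma> \<eta> * \<eta>) = sigma_form \<sigma> X \<xi> \<eta>"
    using assms(1,2) by (auto simp: sigma_bilinear_def sigma_form_def field_simps)
  moreover have "\<sigma> \<eta> * \<eta> \<noteq> 0" using assms(1,2) by auto
  ultimately show ?thesis using assms(3) by simp
qed

text \<open>Both arguments are written as \<open>(p, q) = q (z, 1) - e (1, 0)\<close>; the term of order
  \<open>q\<^sup>2\<close> vanishes since \<open>(z, 1)\<close> is isotropic.\<close>
lemma sigma_bilinear_isotropic_bound:
  assumes \<sigma>: "\<sigma> = id \<or> \<sigma> = cnj"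
    and zero: "sigma_bilinear \<sigma> X (z, 1) (z, 1) = 0"
    and M: "cmod q * cmod (q' * z - p') \<le> M" "cmod q' * cmod (q * z - p) \<le> M"
    and e: "cmod (q * z - p) \<le> 1" "cmod (q' * z - p') \<le> 1"
  shows "cmod (sigma_bilinear \<sigma> X (p, q) (p', q')) \<le>
    M * cmod (sigma_bilinear \<sigma> X (z, 1) (1, 0)) + M * cmod (sigma_bilinear \<sigma> X (1, 0) (z, 1))
    + cmod (X$1$1)"
proof -
  define d d' where "d = q * z - p" and "d' = q' * z - p'"
  have p: "p = q * z - d" "p' = q' * z - d'" by (auto simp: d_def d'_def)
  have nrm: "cmod (\<sigma> x) = cmod x" for x using \<sigma> by auto
  let ?B = "sigma_bilinear \<sigma> X"
  \<comment> \<open>Expansion in both arguments; \<open>X$1$1\<close> is the value of the form at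
    \<open>(1, 0)\<close> and \<open>(1, 0)\<close>.\<close>
  have "?B (p, q) (p', q') = \<sigma> q * q' * ?B (z, 1) (z, 1)
      - \<sigma> q * d' * ?B (z, 1) (1, 0) - \<sigma> d * q' * ?B (1, 0) (z, 1) + \<sigma> d * d' * X$1$1"
    using \<sigma> by (auto simp: sigma_bilinear_def p algebra_simps)
  then have eq: "?B (p, q) (p', q') =
      - (\<sigma> q * d' * ?B (z, 1) (1, 0)) - \<sigma> d * q' * ?B (1, 0) (z, 1) + \<sigma> d * d' * X$1$1"
    by (simp add: zero)
  have "cmod (?B (p, q) (p', q')) \<le> cmod (\<sigma> q * d' * ?B (z, 1) (1, 0))
      + cmod (\<sigma> d * q' * ?B (1, 0) (z, 1)) + cmod (\<sigma> d * d' * X$1$1)"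
    unfolding eq by (rule order_trans[OF norm_triangle_ineq add_right_mono])
      (use norm_triangle_ineq4 norm_minus_cancel in metis)
  also have "cmod (\<sigma> q * d' * ?B (z, 1) (1, 0)) \<le> M * cmod (?B (z, 1) (1, 0))"
    using M(1) by (simp add: norm_mult nrm d'_def mult_right_mono)
  also have "cmod (\<sigma> d * q' * ?B (1, 0) (z, 1)) \<le> M * cmod (?B (1, 0) (z, 1))"
    using M(2) by (simp add: norm_mult nrm d_def mult_right_mono mult.commute)
  also have "cmod (\<sigma> d * d' * X$1$1) \<le> cmod (X$1$1)"
  proof -
    have "cmod d * cmod d' \<le> 1" using e by (intro mult_le_one) (auto simp: d_def d'_def)
    then show ?thesis by (simp add: norm_mult nrm mult_left_le_one_le)
  qed
  finally show ?thesis by simp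
qed

section \<open>Boundedness along a neat set\<close>

lemma vec_norm_le:
  fixes v :: "'b::real_normed_vector^'k"
  assumes "\<And>i. norm (v $ i) \<le> c"
  shows "norm v \<le> real CARD('k) * c"
proof -
  have "norm v \<le> (\<Sum>i\<in>UNIV. norm (v $ i))"
    unfolding norm_vec_def by (rule L2_set_le_sum) simp
  also have "\<dots> \<le> real CARD('k) * c"
    using assms by (intro sum_bounded_above) auto
  finally show ?thesis .
qed

lemma matrix_norm_le:
  fixes A :: "complex^'n^'m"
  assumes "\<And>i j. cmod (A $ i $ j) \<le> C"
  shows "norm A \<le> real CARD('m) * (real CARD('n) * C)"
  by (intro vec_norm_le assms)

text \<open>Any real \<open>r\<close> strictly between 1 and the lower limit is eventually a lower
  bound along \<open>N\<close>; then \<open>\<delta> = r - 1\<close>.\<close>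

lemma neat_eventually:
  assumes "neat z a N"
  obtains zs \<delta> m where "is_iteration_seq z a zs" "0 < \<delta>"
    "\<And>n. n \<in> N \<Longrightarrow> m \<le> n \<Longrightarrow> 1 + \<delta> \<le> cmod (zs (Suc n))"
proof -
  obtain zs where it: "is_iteration_seq z a zs"
    and L: "Liminf (inf sequentially (principal N)) (\<lambda>n. ereal (cmod (zs (Suc n)))) > 1"
    using assms by (auto simp: neat_def)
  obtain r where r: "1 < ereal r"
    "ereal r < Liminf (inf sequentially (principal N)) (\<lambda>n. ereal (cmod (zs (Suc n))))"
    using ereal_dense2[OF L] by auto
  then have "eventually (\<lambda>n. ereal r < ereal (cmod (zs (Suc n)))) (inf sequentially (principal N))"
    by (intro less_LiminfD)
  then obtain m where m: "\<And>n. n \<in> N \<Longrightarrow> m \<le> n \<Longrightarrow> r < cmod (zs (Suc n))"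
    by (auto simp: eventually_inf_principal eventually_sequentially)
  show ?thesis
  proof (rule that[OF it])
    show "0 < r - 1" using r(1) by simp
    show "1 + (r - 1) \<le> cmod (zs (Suc n))" if "n \<in> N" "m \<le> n" for n
      using m[OF that] by simp
  qed
qed

lemma bounded_sigma_transforms:
  assumes \<sigma>: "\<sigma> = id \<or> \<sigma> = cnj"
    and zero: "sigma_bilinear \<sigma> X (z, 1) (z, 1) = 0"
    and N: "neat z a N"
  shows "bounded {sigma_transform \<sigma> X (cf_g a n) | n. n \<in> N}"
proof -
  obtain zs \<delta> m where it: "is_iteration_seq z a zs" and \<delta>: "0 < \<delta>"
    and m: "\<And>n. n \<in> N \<Longrightarrow> m \<le> n \<Longrightarrow> 1 + \<delta> \<le> cmod (zs (Suc n))"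
    using neat_eventually[OF N] by metis
  define M where "M = (1 + \<delta>) / \<delta>"
  define C where "C = M * cmod (sigma_bilinear \<sigma> X (z, 1) (1, 0))
    + M * cmod (sigma_bilinear \<sigma> X (1, 0) (z, 1)) + cmod (X$1$1)"
  let ?T = "\<lambda>n. sigma_transform \<sigma> X (cf_g a n)"
  have entry: "cmod (?T n $ i $ j) \<le> C" if n: "n \<in> N" "m \<le> n" for n i j
  proof -
    have q: "cmod (cf_q a n) \<le> cmod (cf_q a (Suc n))" using N n(1) by (auto simp: neat_def)
    obtain s t where st: "s \<in> {n, Suc n}" "t \<in> {n, Suc n}"
      and eq: "?T n $ i $ j = sigma_bilinear \<sigma> X (cf_p a s, cf_q a s) (cf_p a t, cf_q a t)"
      using sigma_transform_cf_g_component by meson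
    note le = cf_err_mult_q_le[OF it q m[OF n] \<delta>, folded M_def, unfolded cf_err_def]
    note le1 = cf_err_norm_le_1[OF it, unfolded cf_err_def]
    show ?thesis
      unfolding eq C_def
      \<comment> \<open>Both mixed products are needed, hence the second instance with
        \<open>s\<close> and \<open>t\<close> exchanged.\<close>
      by (rule sigma_bilinear_isotropic_bound[OF \<sigma> zero le[OF st] le[OF st(2,1)] le1 le1])
  qed
  have "bounded (?T ` {n \<in> N. m \<le> n})"
    using matrix_norm_le[OF entry] by (intro boundedI) blast
  \<comment> \<open>Neatness gives no uniform gap below \<open>m\<close>, but only finitely many
    matrices arise there.\<close>
  moreover have "finite (?T ` {n \<in> N. n < m})" by simp
  ultimately have "bounded (?T ` {n \<in> N. m \<le> n} \<union> ?T ` {n \<in> N. n < m})"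
    by (simp add: finite_imp_bounded)
  then show ?thesis by (rule bounded_subset) (force simp: not_le)
qed

section \<open>Integrality and finiteness\<close>

text \<open>The entries are linear in \<open>X\<close>, so a single factor \<open>k\<close> clears
  all denominators. Closure under conjugation handles \<open>\<sigma> = cnj\<close>.\<close>

lemma sigma_transform_entry_in_subring:
  assumes \<Gamma>: "discrete_subring \<Gamma>" and \<sigma>: "\<sigma> = id \<or> \<sigma> = cnj" and a: "\<And>n. a n \<in> \<Gamma>"
    and X: "X \<in> mat2_over {\<gamma> / of_nat k | \<gamma>. \<gamma> \<in> \<Gamma>}" and k: "k > 0"
  shows "of_nat k * sigma_transform \<sigma> X (cf_g a n) $ i $ j \<in> \<Gamma>"
proof -
  obtain s t where eq: "sigma_transform \<sigma> X (cf_g a n) $ i $ j =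
      sigma_bilinear \<sigma> X (cf_p a s, cf_q a s) (cf_p a t, cf_q a t)"
    using sigma_transform_cf_g_component by meson
  have kX: "of_nat k * X $ i $ j \<in> \<Gamma>" for i j
  proof -
    obtain \<gamma> where "\<gamma> \<in> \<Gamma>" "X $ i $ j = \<gamma> / of_nat k"
      using X unfolding mat2_over_def by blast
    then show ?thesis using k by simp
  qed
  have sig: "\<sigma> x \<in> \<Gamma>" if "x \<in> \<Gamma>" for x
    using \<sigma> discrete_subring_cnj[OF \<Gamma> that] that by auto
  have "of_nat k * sigma_transform \<sigma> X (cf_g a n) $ i $ j =
      \<sigma> (cf_p a s) * ((of_nat k * X$1$1) * cf_p a t + (of_nat k * X$1$2) * cf_q a t)
      + \<sigma> (cf_q a s) * ((of_nat k * X$2$1) * cf_p a t + (of_nat k * X$2$2) * cf_q a t)"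
    unfolding eq by (simp add: sigma_bilinear_def algebra_simps)
  also have "\<dots> \<in> \<Gamma>"
    by (intro discrete_subring_add discrete_subring_mult \<Gamma> kX sig cf_p_in_subring[OF \<Gamma> a]
        cf_q_in_subring[OF \<Gamma> a])
  finally show ?thesis .
qed

text \<open>The entries scaled by \<open>k\<close> range over a bounded, hence finite, part of the
  ring, and they determine the matrix because \<open>k\<close> is nonzero.\<close>

lemma finite_bounded_matrices_over_subring:
  assumes \<Gamma>: "discrete_subring \<Gamma>" and k: "k > 0" and S: "bounded S"
    and entry: "\<And>A i j. A \<in> S \<Longrightarrow> of_nat k * (A :: complex^2^2) $ i $ j \<in> \<Gamma>"
  shows "finite S"
proof -
  obtain B where B: "\<And>A. A \<in> S \<Longrightarrow> norm A \<le> B" using S by (auto simp: bounded_iff)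
  define V where "V = {v \<in> \<Gamma>. cmod v \<le> of_nat k * B}"
  have "finite V"
    by (rule finite_discrete_subring_bounded[OF \<Gamma>]) (auto simp: V_def bounded_iff)
  let ?F = "\<lambda>A::complex^2^2. (of_nat k * A$1$1, of_nat k * A$1$2, of_nat k * A$2$1, of_nat k * A$2$2)"
  have in_V: "of_nat k * A $ i $ j \<in> V" if "A \<in> S" for A i j
  proof -
    have "cmod (A $ i $ j) \<le> B"
      using B[OF that] Finite_Cartesian_Product.norm_nth_le[of A i]
        Finite_Cartesian_Product.norm_nth_le[of "A $ i" j] by linarith
    then have "cmod (of_nat k * A $ i $ j) \<le> of_nat k * B"
      by (simp add: norm_mult mult_left_mono)
    then show ?thesis using entry[OF that] by (simp add: V_def)
  qed
  have "?F ` S \<subseteq> V \<times> V \<times> V \<times> V" using in_V by auto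
  then have "finite (?F ` S)" using \<open>finite V\<close> by (meson finite_SigmaI finite_subset)
  moreover have "inj_on ?F S"
    using k by (auto simp: inj_on_def vec_eq_iff forall_2)
  ultimately show ?thesis by (rule finite_imageD)
qed

theorem theorem3p1:
  fixes \<Gamma> :: "complex set" and \<sigma> :: "complex \<Rightarrow> complex"
    and X :: "complex^2^2" and \<xi> \<eta> :: complex
    and a :: "nat \<Rightarrow> complex" and N :: "nat set"
  assumes "discrete_subring \<Gamma>"
    and "\<sigma> = id \<or> \<sigma> = cnj"
    and "sigma_symmetric \<sigma> X"
    and "nontrivial_zero \<Gamma> (sigma_form \<sigma> X) \<xi> \<eta>"
    and "is_cf_expansion \<Gamma> (\<xi> / \<eta>) a"
    and "infinite N"
    and "neat (\<xi> / \<eta>) a N"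
  shows "bounded {sigma_transform \<sigma> X (cf_g a n) | n. n \<in> N} \<and>
    (\<forall>k::nat. k > 0 \<longrightarrow> X \<in> mat2_over {\<gamma> / of_nat k | \<gamma>. \<gamma> \<in> \<Gamma>} \<longrightarrow>
       finite {sigma_transform \<sigma> X (cf_g a n) | n. n \<in> N})"
proof (intro conjI allI impI)
  have a: "\<And>n. a n \<in> \<Gamma>" using assms(5) by (simp add: is_cf_expansion_def)
  have zero: "sigma_bilinear \<sigma> X (\<xi> / \<eta>, 1) (\<xi> / \<eta>, 1) = 0"
    using assms(4) by (intro sigma_form_ratio_zero assms(2)) (auto simp: nontrivial_zero_def)
  show bdd: "bounded {sigma_transform \<sigma> X (cf_g a n) | n. n \<in> N}"
    by (rule bounded_sigma_transforms[OF assms(2) zero assms(7)])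
  fix k :: nat
  assume k: "k > 0" and X: "X \<in> mat2_over {\<gamma> / of_nat k | \<gamma>. \<gamma> \<in> \<Gamma>}"
  show "finite {sigma_transform \<sigma> X (cf_g a n) | n. n \<in> N}"
    using sigma_transform_entry_in_subring[where a = a, OF assms(1,2) a X k]
    by (intro finite_bounded_matrices_over_subring[OF assms(1) k bdd]) blast
qed

end
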